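(* Let $n\geq 1$ be an odd integer. The renormalized volume $V$ of hyperbolic space $\mathbb{H}^{n+1}$, i.e. of the unit ball in $\mathbb{R}^{n+1}$ with the metric $g_+=4(1-|x|^2)^{-2}\sum_i (dx^i)^2$, is $$V=(-1)^{\frac{n+1}{2}}\,\frac{\pi^{\frac{n+2}{2}}}{\Gamma\left(\frac{n+2}{2}\right)}.$$
   Context: Let $X^{n+1}$ be the interior of a compact manifold with boundary $\overline{X}$, $M=\partial X$. A defining function for $M$ is a function $r$ near $M$ in $\overline{X}$ with $r>0$ in $X$, and $r=0$, $dr\ne0$ on $M$. A metric $g_+$ on $X$ is conformally compact if $\overline{g}=r^2g_+$ extends (with sufficient regularity) to a metric up to $M$; the conformal class of $\overline{g}|_{TM}$ is the conformal infinity of $g_+$. If moreover $\mathrm{Ric}(g_+)=-ng_+$, each metric $g$ on $M$ in the conformal infinity determines a unique special defining function $r$ near $M$ such that $\overline{g}=r^2g_+$ satisfies $\overline{g}|_{TM}=g$ and $|dr|^2_{\overline{g}}=1$. For $n$ odd (and $g_+$ sufficiently regular at infinity, as is the hyperbolic metric), as $\epsilon\to0$, $$\mathrm{Vol}_{g_+}(\{r>\epsilon\})=c_0\epsilon^{-n}+c_2\epsilon^{-n+2}+(\text{odd powers})+c_{n-1}\epsilon^{-1}+V+o(1),$$ where $\{r>\epsilon\}$ denotes the complement in $X$ of $\{0<r\le\epsilon\}$. The constant term $V$ is the renormalized volume of $(X,g_+)$; for $n$ odd it does not depend on the choice of the representative $g$ of the conformal infinity. For hyperbolic space, $r=\frac{1-|x|}{1+|x|}$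 is a special defining function, associated to the representative $g_0=\frac14(\text{usual metric on }\mathbb{S}^n)$ of the conformal infinity. *)

theory Defs
  imports "HOL-Analysis.Analysis"
begin

text \<open>
  Everything takes place on the closed unit ball of \<open>real ^ 'd\<close>, a compact manifold with interior
  \<open>X = ball 0 1\<close> and boundary \<open>M = sphere 0 1\<close>; so \<open>CARD('d) = n + 1\<close>.
  Riemannian metrics are matrix-valued functions, via the standard coordinates.
\<close>

primrec Ck_on :: "nat \<Rightarrow> 'a::euclidean_space set \<Rightarrow> ('a \<Rightarrow> 'b::real_normed_vector) \<Rightarrow> bool" where
  "Ck_on 0 S f \<longleftrightarrow> continuous_on S f"
| "Ck_on (Suc k) S f \<longleftrightarrow>
     (\<forall>x\<in>S. f differentiable (at x)) \<and> (\<forall>v. Ck_on k S (\<lambda>x. frechet_derivative f (at x) v))"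

text \<open>Intended for open \<open>S\<close>.\<close>

definition smooth_on :: "'a::euclidean_space set \<Rightarrow> ('a \<Rightarrow> 'b::real_normed_vector) \<Rightarrow> bool" where
  "smooth_on S f \<longleftrightarrow> (\<forall>k. Ck_on k S f)"

type_synonym 'd metric = "real ^ 'd \<Rightarrow> real ^ 'd ^ 'd"

definition inner_product_matrix :: "real ^ 'd ^ 'd \<Rightarrow> bool" where
  "inner_product_matrix A \<longleftrightarrow> transpose A = A \<and> (\<forall>v. v \<noteq> 0 \<longrightarrow> v \<bullet> (A *v v) > 0)"

definition riemannian_metric_on_ball :: "'d::finite metric \<Rightarrow> bool" where
  "riemannian_metric_on_ball g \<longleftrightarrow>
     smooth_on (ball 0 1) g \<and> (\<forall>x\<in>ball 0 1. inner_product_matrix (g x))"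

definition riemannian_measure :: "'d::finite metric \<Rightarrow> (real ^ 'd) measure" where
  "riemannian_measure g = density lborel (\<lambda>x. ennreal (sqrt (det (g x))) * indicator (ball 0 1) x)"

definition grad :: "(real ^ 'd \<Rightarrow> real) \<Rightarrow> real ^ 'd \<Rightarrow> real ^ 'd" where
  "grad f x = (\<chi> i. frechet_derivative f (at x) (axis i 1))"

text \<open>The squared length of the covector \<open>df\<close>, hence the inverse matrix.\<close>

definition norm_d_sq :: "'d::finite metric \<Rightarrow> (real ^ 'd \<Rightarrow> real) \<Rightarrow> real ^ 'd \<Rightarrow> real" where
  "norm_d_sq g f x = grad f x \<bullet> (matrix_inv (g x) *v grad f x)"

text \<open>
  A function or tensor that is smooth up to \<open>M\<close> near \<open>M\<close> is represented by a smooth extension to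
  an open subset \<open>W\<close> of \<open>real ^ 'd\<close> containing \<open>M\<close>. All conditions other than smoothness are
  imposed on the part of \<open>W\<close> in the closed ball only; there, boundary included, the first
  derivatives do not depend on the extension.
\<close>

definition defining_function :: "(real ^ 'd::finite) set \<Rightarrow> (real ^ 'd \<Rightarrow> real) \<Rightarrow> bool" where
  "defining_function W r \<longleftrightarrow>
     open W \<and> sphere 0 1 \<subseteq> W \<and> smooth_on W r \<and>
     (\<forall>x\<in>W \<inter> ball 0 1. r x > 0) \<and>
     (\<forall>x\<in>sphere 0 1. r x = 0 \<and> grad r x \<noteq> 0)"

definition compactified_metric ::
  "'d::finite metric \<Rightarrow> (real ^ 'd) set \<Rightarrow> (real ^ 'd \<Rightarrow> real) \<Rightarrow> 'd metric \<Rightarrow> bool" where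
  "compactified_metric gp W r gbar \<longleftrightarrow>
     defining_function W r \<and> smooth_on W gbar \<and>
     (\<forall>x\<in>W \<inter> ball 0 1. gbar x = (r x)\<^sup>2 *\<^sub>R gp x) \<and>
     (\<forall>x\<in>W \<inter> cball 0 1. inner_product_matrix (gbar x))"

definition conformally_compact :: "'d::finite metric \<Rightarrow> bool" where
  "conformally_compact gp \<longleftrightarrow>
     riemannian_metric_on_ball gp \<and> (\<exists>W r gbar. compactified_metric gp W r gbar)"

text \<open>
  A metric \<open>h\<close> on \<open>M\<close> is given by bilinear forms \<open>h p u v\<close>, of which only the values at
  \<open>p\<close> in the unit sphere and \<open>u\<close>, \<open>v\<close> orthogonal to \<open>p\<close> matter.
\<close>

type_synonym 'd boundary_metric = "real ^ 'd \<Rightarrow> real ^ 'd \<Rightarrow> real ^ 'd \<Rightarrow> real"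

definition in_conformal_infinity :: "'d::finite metric \<Rightarrow> 'd boundary_metric \<Rightarrow> bool" where
  "in_conformal_infinity gp h \<longleftrightarrow>
     (\<exists>W r gbar \<phi>. compactified_metric gp W r gbar \<and> smooth_on W \<phi> \<and>
        (\<forall>p\<in>sphere 0 1. \<phi> p > (0::real) \<and>
           (\<forall>u v. p \<bullet> u = 0 \<and> p \<bullet> v = 0 \<longrightarrow> h p u v = \<phi> p * (u \<bullet> (gbar p *v v)))))"

definition special_defining_function ::
  "'d::finite metric \<Rightarrow> 'd boundary_metric \<Rightarrow> (real ^ 'd) set \<Rightarrow> (real ^ 'd \<Rightarrow> real) \<Rightarrow> bool" where
  "special_defining_function gp h W r \<longleftrightarrow>
     (\<exists>gbar. compactified_metric gp W r gbar \<and>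
        (\<forall>p\<in>sphere 0 1. \<forall>u v. p \<bullet> u = 0 \<and> p \<bullet> v = 0 \<longrightarrow> u \<bullet> (gbar p *v v) = h p u v) \<and>
        (\<forall>x\<in>W \<inter> cball 0 1. norm_d_sq gbar r x = 1))"

text \<open>\<open>{r > \<epsilon>}\<close> is the complement in \<open>X\<close> of \<open>{0 < r \<le> \<epsilon>}\<close>, as \<open>r\<close> is only meaningful on \<open>W\<close>.\<close>

definition superlevel :: "(real ^ 'd::finite) set \<Rightarrow> (real ^ 'd \<Rightarrow> real) \<Rightarrow> real \<Rightarrow> (real ^ 'd) set" where
  "superlevel W r \<epsilon> = ball 0 1 - {x \<in> W \<inter> ball 0 1. 0 < r x \<and> r x \<le> \<epsilon>}"

text \<open>
  The expansion for odd \<open>n\<close>. Finiteness is required separately because \<open>measure\<close> is 0 on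
  sets of infinite measure.
\<close>

definition volume_expansion ::
  "nat \<Rightarrow> 'd::finite metric \<Rightarrow> (real ^ 'd) set \<Rightarrow> (real ^ 'd \<Rightarrow> real) \<Rightarrow> (nat \<Rightarrow> real) \<Rightarrow> real \<Rightarrow> bool" where
  "volume_expansion n gp W r c V \<longleftrightarrow>
     (\<forall>\<^sub>F \<epsilon> in at_right 0. emeasure (riemannian_measure gp) (superlevel W r \<epsilon>) < \<infinity>) \<and>
     ((\<lambda>\<epsilon>. measure (riemannian_measure gp) (superlevel W r \<epsilon>)
            - (\<Sum>j\<le>(n - 1) div 2. c (2 * j) * \<epsilon> powi (2 * int j - int n)))
        \<longlongrightarrow> V) (at_right 0)"

text \<open>
  \<open>V\<close> is the constant term in the volume expansion for the special defining function of a
  representative \<open>h\<close> of the conformal infinity. For Einstein metrics (\<open>Ric = - n gp\<close>, such as the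
  hyperbolic metric) and \<open>n\<close> odd, \<open>V\<close> does not depend on \<open>h\<close>, and near \<open>M\<close> the function \<open>r\<close> is
  determined by \<open>h\<close>; the definition is intended for such metrics.
\<close>

definition is_renormalized_volume :: "'d::finite metric \<Rightarrow> real \<Rightarrow> bool" where
  "is_renormalized_volume gp V \<longleftrightarrow>
     conformally_compact gp \<and>
     (\<exists>h W r c. in_conformal_infinity gp h \<and> special_defining_function gp h W r \<and>
        volume_expansion (CARD('d) - 1) gp W r c V)"

definition hyperbolic_metric :: "'d::finite metric" where
  "hyperbolic_metric x = mat (4 / (1 - (norm x)\<^sup>2)\<^sup>2)"

end

theory Submission
  imports Defs
begin

text \<open>
  The representative of the conformal infinity is a quarter of the round metric, with special
  defining function \<open>r = (1 - norm x) / (1 + norm x)\<close>: the compactified metric is the multiple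
  \<open>4 / (1 + norm x) ^ 4\<close> of the Euclidean one (lemma \<open>compactified_metric_hyperbolic\<close>), and \<open>r\<close> has gradient of
  length 1 for it (lemma \<open>special_defining_function_hyperbolic\<close>).

  The set where \<open>r > \<epsilon>\<close> is a Euclidean ball centred at the origin, that is, the hyperbolic ball of
  radius \<open>- ln \<epsilon>\<close>. Its volume is the area of the unit sphere of dimension \<open>n\<close> times the integral of
  \<open>sinh \<rho> ^ n\<close> over \<open>0 \<le> \<rho> \<le> - ln \<epsilon>\<close>. In the variable \<open>t = exp (- \<rho>)\<close> the integrand is, up to the factor
  \<open>2 ^ n\<close>, a Laurent polynomial \<open>(1 / t - t) ^ n / t\<close>, which for odd \<open>n\<close> contains no power \<open>1 / t\<close>. So it
  has a primitive \<open>sinh_primitive n\<close> made of odd powers of \<open>t\<close> alone; its value at \<open>\<epsilon>\<close> yields the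
  divergent terms and terms tending to 0 but no constant, and the renormalized volume is the contribution
  of the end point \<open>t = 1\<close> (lemmas \<open>emeasure_hyperbolic_ball\<close> and \<open>volume_expansion_hyperbolic\<close>).

  That contribution is an alternating sum of binomial coefficients equal to
  \<open>Beta (- n / 2) (n + 1) / 2\<close>, the analytic continuation of Euler's integral. The functional equations of
  Gamma collapse its product with the area of the sphere, divided by \<open>2 ^ n\<close>, to \<open>pi powr (n / 2) * Gamma (- n / 2)\<close>, and
  Euler's reflection formula gives the stated value (lemma \<open>sinh_primitive_1\<close>).
\<close>

section \<open>Functions of class \<open>C\<^sup>k\<close>\<close>

lemma Ck_on_cong:
  assumes "open S" "\<And>x. x \<in> S \<Longrightarrow> f x = g x" "Ck_on k S f"
  shows "Ck_on k S g"
  using assms(2,3)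
proof (induction k arbitrary: f g)
  case 0
  then show ?case using continuous_on_cong by fastforce
next
  case (Suc k)
  have diff: "f differentiable (at x)" if "x \<in> S" for x
    using Suc.prems that by simp
  have eq: "frechet_derivative f (at x) = frechet_derivative g (at x)" if "x \<in> S" for x
    using frechet_derivative_transform_within_open[OF diff[OF that] \<open>open S\<close> that] Suc.prems by blast
  have "g differentiable (at x)" if "x \<in> S" for x
    using diff[OF that] that Suc.prems(1) \<open>open S\<close>
    unfolding differentiable_def by (blast intro: has_derivative_transform_within_open)
  moreover have "Ck_on k S (\<lambda>x. frechet_derivative g (at x) v)" for v
  proof (rule Suc.IH[of "\<lambda>x. frechet_derivative f (at x) v"])
    show "frechet_derivative f (at x) v = frechet_derivative g (at x) v" if "x \<in> S" for x
      by (simp only: eq[OF that])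
    show "Ck_on k S (\<lambda>x. frechet_derivative f (at x) v)" using Suc.prems(2) by simp
  qed
  ultimately show ?case by simp
qed

text \<open>The recursion defining \<open>Ck_on\<close> speaks of \<open>frechet_derivative\<close>, a choice; this rule replaces it
  by any explicit formula for the derivative, on which the closure properties below rest.\<close>

lemma Ck_on_SucI:
  assumes "open S" "\<And>x. x \<in> S \<Longrightarrow> (f has_derivative f' x) (at x)"
    and "\<And>v. Ck_on k S (\<lambda>x. f' x v)"
  shows "Ck_on (Suc k) S f"
proof -
  have "frechet_derivative f (at x) = f' x" if "x \<in> S" for x
    using assms(2)[OF that] frechet_derivative_at by metis
  then have "Ck_on k S (\<lambda>x. frechet_derivative f (at x) v)" for v
    by (intro Ck_on_cong[OF \<open>open S\<close> _ assms(3)[of v]]) simp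
  then show ?thesis
    using assms(2) by (auto simp: differentiable_def)
qed

lemma Ck_on_has_derivative:
  "Ck_on (Suc k) S f \<Longrightarrow> x \<in> S \<Longrightarrow> (f has_derivative frechet_derivative f (at x)) (at x)"
  by (simp add: frechet_derivative_works)

lemma Ck_on_Suc_imp: "Ck_on (Suc k) S f \<Longrightarrow> Ck_on k S f"
proof (induction k arbitrary: f)
  case 0
  then show ?case
    by (auto intro!: continuous_at_imp_continuous_on differentiable_imp_continuous_within)
next
  case (Suc k)
  then show ?case by (metis Ck_on.simps(2))
qed

lemma Ck_on_const: "Ck_on k S (\<lambda>x. c)"
  by (induction k arbitrary: c) auto

lemma Ck_on_linear:
  assumes "open S" "bounded_linear f"
  shows "Ck_on k S f"
proof (cases k)
  case 0
  then show ?thesis using assms by (simp add: linear_continuous_on)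
next
  case (Suc m)
  show ?thesis unfolding Suc
    by (rule Ck_on_SucI[where f' = "\<lambda>x. f"])
       (use assms in \<open>auto intro: bounded_linear_imp_has_derivative Ck_on_const\<close>)
qed

lemma Ck_on_add:
  assumes "open S" "Ck_on k S f" "Ck_on k S g"
  shows "Ck_on k S (\<lambda>x. f x + g x)"
  using assms(2,3)
proof (induction k arbitrary: f g)
  case 0
  then show ?case by (auto intro: continuous_intros)
next
  case (Suc k)
  show ?case
    by (rule Ck_on_SucI[OF \<open>open S\<close>
        has_derivative_add[OF Ck_on_has_derivative[OF Suc.prems(1)] Ck_on_has_derivative[OF Suc.prems(2)]]])
       (use Suc in auto)
qed

lemma Ck_on_bilinear:
  assumes "bounded_bilinear p" "open S" "Ck_on k S f" "Ck_on k S g"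
  shows "Ck_on k S (\<lambda>x. p (f x) (g x))"
  using assms(3,4)
proof (induction k arbitrary: f g)
  case 0
  then show ?case using bounded_bilinear.continuous_on[OF assms(1)] by auto
next
  case (Suc k)
  then have "Ck_on k S f" "Ck_on k S g"
    using Ck_on_Suc_imp by blast+
  then show ?case
    by (intro Ck_on_SucI[OF \<open>open S\<close> bounded_bilinear.FDERIV[OF assms(1)
        Ck_on_has_derivative[OF Suc.prems(1)] Ck_on_has_derivative[OF Suc.prems(2)]]])
       (use Suc in \<open>auto intro!: Ck_on_add \<open>open S\<close>\<close>)
qed

lemma Ck_on_mult:
  fixes f g :: "'a::euclidean_space \<Rightarrow> real"
  shows "open S \<Longrightarrow> Ck_on k S f \<Longrightarrow> Ck_on k S g \<Longrightarrow> Ck_on k S (\<lambda>x. f x * g x)"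
  by (rule Ck_on_bilinear[OF bounded_bilinear_mult])

lemma Ck_on_power:
  fixes f :: "'a::euclidean_space \<Rightarrow> real"
  shows "open S \<Longrightarrow> Ck_on k S f \<Longrightarrow> Ck_on k S (\<lambda>x. f x ^ m)"
  by (induction m) (auto intro: Ck_on_mult Ck_on_const)

text \<open>The derivative of \<open>1/f\<close> is a polynomial in \<open>1/f\<close> and the derivative of \<open>f\<close>, so \<open>1/f\<close> gains one
  order of differentiability at each step.\<close>

lemma Ck_on_inverse:
  fixes f :: "'a::euclidean_space \<Rightarrow> real"
  assumes "open S" "Ck_on k S f" "\<And>x. x \<in> S \<Longrightarrow> f x \<noteq> 0"
  shows "Ck_on k S (\<lambda>x. inverse (f x))"
  using assms(2)
proof (induction k)
  case 0
  then show ?case using assms by (auto intro: continuous_intros)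
next
  case (Suc k)
  then have "Ck_on k S (\<lambda>x. inverse (f x))" using Ck_on_Suc_imp by blast
  moreover have "Ck_on k S (\<lambda>x. frechet_derivative f (at x) v)" for v
    using Suc.prems by simp
  ultimately have "Ck_on k S (\<lambda>x. -1 * (inverse (f x) * frechet_derivative f (at x) v * inverse (f x)))" for v
    by (intro Ck_on_mult Ck_on_const \<open>open S\<close>)
  then show ?case
    by (intro Ck_on_SucI[OF \<open>open S\<close> Deriv.has_derivative_inverse[OF assms(3)
        Ck_on_has_derivative[OF Suc.prems(1)]]]) auto
qed

text \<open>The derivative of the norm at \<open>x\<close> in direction \<open>v\<close> is \<open>(x \<bullet> v) / norm x\<close>, which is as often
  differentiable as the norm itself: the induction hypothesis for the norm feeds the step.\<close>

lemma Ck_on_norm: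
  fixes S :: "'a::euclidean_space set"
  assumes "open S" "0 \<notin> S"
  shows "Ck_on k S norm"
proof (induction k)
  case 0
  then show ?case by (auto intro: continuous_intros)
next
  case (Suc k)
  have "Ck_on k S (\<lambda>x. (x \<bullet> v) * inverse (norm x))" for v
  proof (intro Ck_on_mult Ck_on_inverse)
    show "Ck_on k S (\<lambda>x. x \<bullet> v)"
      using assms by (intro Ck_on_linear bounded_linear_inner_left)
  qed (use assms Suc in auto)
  then show ?case
    using assms by (intro Ck_on_SucI[where f' = "\<lambda>x v. (x \<bullet> v) * inverse (norm x)"])
      (auto intro!: has_derivative_eq_rhs[OF has_derivative_norm] simp: sgn_div_norm inner_commute fun_eq_iff)
qed

lemma Ck_on_norm_square:
  fixes S :: "'a::euclidean_space set"
  assumes "open S"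
  shows "Ck_on k S (\<lambda>x. (norm x)\<^sup>2)"
  unfolding power2_norm_eq_inner
  using assms by (intro Ck_on_bilinear[OF bounded_bilinear_inner] Ck_on_linear bounded_linear_ident)

section \<open>Scalar matrices\<close>

lemma mat_eq_scaleR: "mat c = c *\<^sub>R (mat 1 :: real ^ 'd ^ 'd)"
  by (simp add: mat_def vec_eq_iff)

lemma mat_mult_vec: "mat c *v v = c *\<^sub>R (v :: real ^ 'd)"
  by (subst mat_eq_scaleR) (simp add: scaleR_matrix_vector_assoc[symmetric])

lemma det_mat: "det (mat c :: real ^ 'd ^ 'd) = c ^ CARD('d::finite)"
  by (metis det_matrix_scaleR matrix_scaleR)

lemma matrix_inv_mat_vec:
  fixes v :: "real ^ 'd::finite"
  assumes "c \<noteq> 0"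
  shows "matrix_inv (mat c) *v v = (1 / c) *\<^sub>R v"
proof -
  have 1: "mat c ** mat (1 / c) = (mat 1 :: real ^ 'd ^ 'd)" "mat (1/c) ** mat c = (mat 1 :: real ^ 'd ^ 'd)"
    using assms by (simp_all add: matrix_eq mat_mult_vec flip: matrix_vector_mul_assoc)
  then have "invertible (mat c :: real ^ 'd ^ 'd)"
    unfolding invertible_def by blast
  then have "(matrix_inv (mat c) :: real ^ 'd ^ 'd) ** mat c = mat 1"
    unfolding invertible_def matrix_inv_def by (rule someI2_ex) simp
  then have "(matrix_inv (mat c) :: real ^ 'd ^ 'd) *v (mat c *v v') = v'" for v'
    by (simp add: matrix_vector_mul_assoc)
  from this[of "(1 / c) *\<^sub>R v"] show ?thesis
    using assms by (simp add: mat_mult_vec)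
qed

lemma inner_product_matrix_mat: "c > 0 \<Longrightarrow> inner_product_matrix (mat c :: real ^ 'd::finite ^ 'd)"
  by (auto simp: inner_product_matrix_def mat_mult_vec)

lemma smooth_on_mat:
  fixes f :: "real ^ 'd \<Rightarrow> real"
  assumes "open S" "\<And>k. Ck_on k S f"
  shows "smooth_on S (\<lambda>x. mat (f x) :: real ^ 'd ^ 'd)"
  unfolding smooth_on_def mat_eq_scaleR[of "f _"]
  by (intro allI Ck_on_bilinear[OF bounded_bilinear_scaleR] Ck_on_const assms)

section \<open>The hyperbolic metric and its conformal compactification\<close>

lemma riemannian_metric_hyperbolic: "riemannian_metric_on_ball (hyperbolic_metric :: 'd::finite metric)"
proof -
  have lt: "(norm x)\<^sup>2 < 1" if "x \<in> ball 0 1" for x :: "real ^ 'd"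
    using that by (simp add: abs_square_less_1)
  have "Ck_on k (ball 0 1) (\<lambda>x :: real ^ 'd. 4 * inverse (1 + -1 * (norm x)\<^sup>2) ^ 2)" for k
    by (intro Ck_on_mult Ck_on_power Ck_on_inverse Ck_on_add Ck_on_norm_square Ck_on_const) (use lt in force)+
  then have "smooth_on (ball 0 1) (hyperbolic_metric :: 'd metric)"
    unfolding hyperbolic_metric_def[abs_def]
    by (intro smooth_on_mat) (simp_all add: divide_inverse power_inverse)
  moreover have "inner_product_matrix (hyperbolic_metric x)" if "x \<in> ball 0 1" for x :: "real ^ 'd"
    unfolding hyperbolic_metric_def using lt[OF that] by (intro inner_product_matrix_mat) simp
  ultimately show ?thesis unfolding riemannian_metric_on_ball_def by blast
qed

lemma grad_special:
  fixes x :: "real ^ 'd::finite"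
  assumes "x \<noteq> 0"
  shows "grad (\<lambda>x. (1 - norm x) / (1 + norm x)) x = - (2 / ((1 + norm x)\<^sup>2 * norm x)) *\<^sub>R x"
proof -
  have p: "1 + norm x \<noteq> 0" by (metis add_pos_nonneg norm_ge_zero zero_less_one less_irrefl)
  have "((\<lambda>t. (1 - t) / (1 + t)) has_real_derivative - (2 / (1 + norm x)\<^sup>2)) (at (norm x))"
    using p by (auto intro!: derivative_eq_intros simp: power2_eq_square divide_simps)
  from has_derivative_compose[OF has_derivative_norm[OF assms] has_field_derivative_imp_has_derivative[OF this]]
  have "frechet_derivative (\<lambda>x. (1 - norm x) / (1 + norm x)) (at x)
      = (\<lambda>h. - (2 / (1 + norm x)\<^sup>2) * (h \<bullet> sgn x))"
    by (rule frechet_derivative_at[symmetric])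
  then show ?thesis
    by (simp add: grad_def vec_eq_iff sgn_div_norm inner_axis' divide_inverse)
qed

text \<open>The origin, the only singularity of the norm, is removed from the neighbourhood of the sphere.\<close>

lemma compactified_metric_hyperbolic:
  "compactified_metric (hyperbolic_metric :: 'd::finite metric) (- {0})
     (\<lambda>x. (1 - norm x) / (1 + norm x)) (\<lambda>x. mat (4 / (1 + norm x) ^ 4))"
proof -
  let ?r = "\<lambda>x :: real ^ 'd. (1 - norm x) / (1 + norm x)"
  have p: "1 + norm x > 0" for x :: "real ^ 'd" by (simp add: add_pos_nonneg)
  then have nz: "1 + norm x \<noteq> 0" for x :: "real ^ 'd" by (metis less_irrefl)
  have inv: "Ck_on k (- {0}) (\<lambda>x :: real ^ 'd. inverse (1 + norm x))" for k
    by (intro Ck_on_inverse Ck_on_add Ck_on_const Ck_on_norm nz) auto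
  have "Ck_on k (- {0}) (\<lambda>x :: real ^ 'd. (1 + -1 * norm x) * inverse (1 + norm x))" for k
    by (intro Ck_on_mult Ck_on_add Ck_on_const Ck_on_norm inv) auto
  then have "smooth_on (- {0}) ?r"
    by (simp add: smooth_on_def divide_inverse)
  moreover have "Ck_on k (- {0}) (\<lambda>x :: real ^ 'd. 4 * inverse (1 + norm x) ^ 4)" for k
    by (intro Ck_on_mult Ck_on_power Ck_on_const inv) auto
  then have "smooth_on (- {0}) (\<lambda>x :: real ^ 'd. mat (4 / (1 + norm x) ^ 4) :: real ^ 'd ^ 'd)"
    by (intro smooth_on_mat) (auto simp: divide_inverse power_inverse)
  moreover have "mat (4 / (1 + norm x) ^ 4) = (?r x)\<^sup>2 *\<^sub>R (hyperbolic_metric x :: real ^ 'd ^ 'd)"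
    if "x \<in> ball 0 1" for x
  proof -
    define s where "s = norm x"
    have s: "0 \<le> s" "s < 1" using that by (auto simp: s_def)
    have "4 / (1 + s) ^ 4 = ((1 - s) / (1 + s))\<^sup>2 * (4 / ((1 - s) * (1 + s))\<^sup>2)"
      using s by (simp add: power_mult_distrib power_divide divide_simps)
    also have "(1 - s) * (1 + s) = 1 - s\<^sup>2" by (simp add: algebra_simps power2_eq_square)
    finally show ?thesis
      unfolding hyperbolic_metric_def s_def[symmetric]
      by (simp add: mat_eq_scaleR[of "_ / _"])
  qed
  moreover have "inner_product_matrix (mat (4 / (1 + norm x) ^ 4) :: real ^ 'd ^ 'd)" for x :: "real ^ 'd"
    using p[of x] nz[of x] by (intro inner_product_matrix_mat) simp
  moreover have "grad ?r x \<noteq> 0" if "x \<in> sphere 0 1" for x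
    using that nz[of x] by (subst grad_special) auto
  ultimately show ?thesis
    using p by (auto simp: compactified_metric_def defining_function_def)
qed

text \<open>At the boundary the compactified metric is \<open>4 / (1 + 1) ^ 4 = 1 / 4\<close> of the Euclidean one, which
  is where the factor in the boundary metric comes from.\<close>

lemma special_defining_function_hyperbolic:
  "special_defining_function (hyperbolic_metric :: 'd::finite metric) (\<lambda>p u v. (u \<bullet> v) / 4) (- {0})
     (\<lambda>x. (1 - norm x) / (1 + norm x))"
proof -
  let ?r = "\<lambda>x :: real ^ 'd. (1 - norm x) / (1 + norm x)"
  have "norm_d_sq (\<lambda>x. mat (4 / (1 + norm x) ^ 4)) ?r x = 1" if "x \<noteq> 0" for x
  proof -
    define s where "s = norm x"
    have s: "s > 0" using that by (simp add: s_def)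
    have "norm_d_sq (\<lambda>x. mat (4 / (1 + norm x) ^ 4)) ?r x
        = (1 + s) ^ 4 / 4 * ((2 / ((1 + s)\<^sup>2 * s))\<^sup>2 * (x \<bullet> x))"
      using s unfolding norm_d_sq_def grad_special[OF that] s_def[symmetric]
      by (subst matrix_inv_mat_vec) (auto simp: power2_eq_square)
    also have "x \<bullet> x = s\<^sup>2" by (simp add: s_def power2_norm_eq_inner)
    also have "(1 + s) ^ 4 / 4 * ((2 / ((1 + s)\<^sup>2 * s))\<^sup>2 * s\<^sup>2) = 1"
      using s by (simp add: power_divide power_mult_distrib flip: power_mult)
    finally show ?thesis .
  qed
  then show ?thesis
    unfolding special_defining_function_def
    by (intro exI[of _ "\<lambda>x. mat (4 / (1 + norm x) ^ 4)"] conjI compactified_metric_hyperbolic)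
       (auto simp: mat_mult_vec)
qed

section \<open>Integration of radial functions\<close>

text \<open>Integration in polar coordinates needs no spherical measure when the integrand is radial: the
  image of Lebesgue measure under the norm is determined by the volumes of balls, and its density is
  the derivative of the volume with respect to the radius.\<close>

lemma distr_norm_lborel:
  "distr (lborel :: 'a::euclidean_space measure) borel norm =
   density lborel (\<lambda>s. ennreal (real DIM('a) * unit_ball_vol DIM('a) * s ^ (DIM('a) - 1) * indicator {0..} s))"
  (is "?M = ?N")
proof (rule measure_eqI_generator_eq[where E = "range atMost" and \<Omega> = UNIV and A = "\<lambda>i. {..real i}"])
  let ?d = "DIM('a)" and ?w = "unit_ball_vol DIM('a)"
  have M: "emeasure ?M {..r} = (if r \<ge> 0 then ennreal (?w * r ^ ?d) else 0)" for r
  proof -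
    have "norm -` {..r} = cball (0::'a) r" by (auto)
    then show ?thesis
      by (auto simp: emeasure_distr emeasure_cball)
  qed
  have N: "emeasure ?N {..r} = (if r \<ge> 0 then ennreal (?w * r ^ ?d) else 0)" for r
  proof -
    have "emeasure ?N {..r} = (\<integral>\<^sup>+s. ennreal (?d * ?w * s ^ (?d - 1)) * indicator {0..r} s \<partial>lborel)"
      by (subst emeasure_density) (auto intro!: nn_integral_cong split: split_indicator)
    also have "\<dots> = (if r \<ge> 0 then ennreal (?w * r ^ ?d) else 0)"
    proof (cases "r \<ge> 0")
      case True
      have "((\<lambda>s. ?w * s ^ ?d) has_real_derivative ?d * ?w * s ^ (?d - 1)) (at s)" for s :: real
        by (auto intro!: derivative_eq_intros)
      then show ?thesis using True
        by (subst nn_integral_FTC_Icc[where F = "\<lambda>s. ?w * s ^ ?d"]) auto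
    qed auto
    finally show ?thesis .
  qed
  show "emeasure ?M X = emeasure ?N X" if "X \<in> range atMost" for X
    using that M N by auto
  show "emeasure ?M {..real i} \<noteq> \<infinity>" for i using M by simp
  show "sets ?M = sigma_sets UNIV (range atMost)" "sets ?N = sigma_sets UNIV (range atMost)"
    by (simp_all add: borel_eq_atMost)
  show "(\<Union>i. {..real i}) = UNIV"
    using real_arch_simple by auto
qed (auto simp: Int_stable_def)

lemma nn_integral_radial:
  fixes f :: "real \<Rightarrow> ennreal"
  assumes [measurable]: "f \<in> borel_measurable borel"
  shows "(\<integral>\<^sup>+x. f (norm (x :: 'a::euclidean_space)) \<partial>lborel) =
    (\<integral>\<^sup>+s. ennreal (real DIM('a) * unit_ball_vol DIM('a) * s ^ (DIM('a) - 1) * indicator {0..} s) * f s \<partial>lborel)"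
proof -
  have "(\<integral>\<^sup>+x. f (norm (x :: 'a)) \<partial>lborel) = (\<integral>\<^sup>+s. f s \<partial>distr (lborel :: 'a measure) borel norm)"
    by (simp add: nn_integral_distr)
  then show ?thesis
    by (simp add: distr_norm_lborel nn_integral_density)
qed

section \<open>The volume of hyperbolic balls\<close>

text \<open>Under \<open>t = exp (- \<rho>)\<close>, where \<open>\<rho>\<close> is the hyperbolic distance from the centre, the differential
  form \<open>(1 / t - t) ^ n / t dt\<close> becomes \<open>- (2 ^ n * sinh \<rho> ^ n) d\<rho>\<close>, the radial volume element up to
  a constant. Its binomial
  expansion is integrated term by term without adding a constant of integration; for odd \<open>n\<close> no
  exponent vanishes, so there is no logarithm and no constant term.\<close>

definition sinh_primitive :: "nat \<Rightarrow> real \<Rightarrow> real" where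
  "sinh_primitive n t =
     (\<Sum>k\<le>n. (-1) ^ k * real (n choose k) * t powi (2 * int k - int n) / (2 * real k - real n))"

lemma sinh_primitive_deriv:
  assumes "odd n" "t > 0"
  shows "(sinh_primitive n has_real_derivative (1 / t - t) ^ n / t) (at t)"
proof -
  have nz: "2 * real k \<noteq> real n" for k
    using assms(1) by (metis even_mult_iff dvd_triv_left of_nat_eq_iff of_nat_mult of_nat_numeral)
  have "(sinh_primitive n has_real_derivative
     (\<Sum>k\<le>n. (-1) ^ k * real (n choose k) * t powi (2 * int k - int n - 1))) (at t)"
    unfolding sinh_primitive_def[abs_def]
    using assms nz by (auto intro!: derivative_eq_intros sum.cong)
  moreover have "(1 / t - t) ^ n / t = (\<Sum>k\<le>n. (-1) ^ k * real (n choose k) * t powi (2 * int k - int n - 1))"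
  proof -
    have "(1 / t - t) ^ n / t = (- t + 1 / t) ^ n / t" by simp
    also have "\<dots> = (\<Sum>k\<le>n. real (n choose k) * (- t) ^ k * (1 / t) ^ (n - k) / t)"
      by (simp only: binomial_ring sum_divide_distrib)
    also have "\<dots> = (\<Sum>k\<le>n. (-1) ^ k * real (n choose k) * t powi (2 * int k - int n - 1))"
    proof (rule sum.cong)
      fix k assume "k \<in> {..n}"
      then have e: "2 * int k - int n - 1 = int k - int (n - k) - 1" by simp
      have "t powi (2 * int k - int n - 1) = t ^ k * (1 / t) ^ (n - k) / t"
        unfolding e using assms(2) by (simp add: power_int_diff power_divide)
      then show "real (n choose k) * (- t) ^ k * (1 / t) ^ (n - k) / t
          = (-1) ^ k * real (n choose k) * t powi (2 * int k - int n - 1)"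
        by (subst power_minus) simp
    qed simp
    finally show ?thesis .
  qed
  ultimately show ?thesis by simp
qed

lemma emeasure_hyperbolic_ball:
  fixes R :: real
  assumes n: "odd n" "CARD('d::finite) = n + 1" and R: "0 \<le> R" "R < 1"
  shows "emeasure (riemannian_measure (hyperbolic_metric :: 'd metric)) (ball 0 R)
    = ennreal (real (n + 1) * unit_ball_vol (real (n + 1)) / 2 ^ n *
        (sinh_primitive n 1 - sinh_primitive n ((1 - R) / (1 + R))))"
proof -
  let ?A = "real (n + 1) * unit_ball_vol (real (n + 1))"
  define f where "f s = ?A * s ^ n * (2 / (1 - s\<^sup>2)) ^ (n + 1)" for s :: real
  define F where "F s = - (?A / 2 ^ n) * sinh_primitive n ((1 - s) / (1 + s))" for s :: real
  have det: "sqrt (det (hyperbolic_metric x :: real ^ 'd ^ 'd)) = (2 / (1 - (norm x)\<^sup>2)) ^ (n + 1)"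
    if "x \<in> ball 0 1" for x :: "real ^ 'd"
  proof -
    have "(norm x)\<^sup>2 < 1" using that by (simp add: abs_square_less_1)
    moreover have "4 / (1 - (norm x)\<^sup>2)\<^sup>2 = (2 / (1 - (norm x)\<^sup>2))\<^sup>2"
      by (simp add: power_divide)
    ultimately show ?thesis
      by (simp only: hyperbolic_metric_def det_mat n(2) real_sqrt_power) simp
  qed
  have "riemannian_measure (hyperbolic_metric :: 'd metric) =
      density lborel (\<lambda>x. ennreal ((2 / (1 - (norm x)\<^sup>2)) ^ (n + 1)) * indicator (ball 0 1) x)"
    unfolding riemannian_measure_def
    by (intro arg_cong[where f = "density lborel"]) (auto simp: fun_eq_iff det split: split_indicator)
  moreover have [measurable]: "ball (0 :: real ^ 'd) 1 \<in> sets borel" by simp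
  have "(\<lambda>x :: real ^ 'd. ennreal ((2 / (1 - (norm x)\<^sup>2)) ^ (n + 1)) * indicator (ball 0 1) x)
      \<in> borel_measurable borel"
    by measurable
  ultimately have "emeasure (riemannian_measure (hyperbolic_metric :: 'd metric)) (ball 0 R)
     = (\<integral>\<^sup>+x. ennreal ((2 / (1 - (norm x)\<^sup>2)) ^ (n + 1)) * indicator (ball 0 1) x * indicator (ball 0 R) (x::real^'d) \<partial>lborel)"
    by (simp only:) (subst emeasure_density, simp_all only: measurable_lborel1, auto)
  also have "\<dots> = (\<integral>\<^sup>+x. ennreal ((2 / (1 - (norm (x::real^'d))\<^sup>2)) ^ (n + 1)) * indicator {..<R} (norm x) \<partial>lborel)"
    using R by (intro nn_integral_cong) (auto split: split_indicator)
  also have "\<dots> = (\<integral>\<^sup>+s. ennreal (?A * s ^ n * indicator {0..} s) * (ennreal ((2 / (1 - s\<^sup>2)) ^ (n + 1)) * indicator {..<R} s) \<partial>lborel)"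
    using nn_integral_radial[where 'a = "real ^ 'd", of "\<lambda>s. ennreal ((2 / (1 - s\<^sup>2)) ^ (n + 1)) * indicator {..<R} s"]
    by (simp add: n)
  also have "\<dots> = (\<integral>\<^sup>+s. ennreal (f s) * indicator {0..R} s \<partial>lborel)"
    using AE_lborel_singleton[of R]
    by (intro nn_integral_cong_AE, eventually_elim)
       (use R in \<open>auto simp: f_def ennreal_mult'[symmetric] mult_ac split: split_indicator\<close>)
  also have "\<dots> = ennreal (F R - F 0)"
  proof (rule nn_integral_FTC_Icc)
    fix s assume "s \<in> {0..R}"
    then have s: "0 \<le> s" "s < 1" using R by auto
    then have s2: "s\<^sup>2 < 1" by (simp add: abs_square_less_1)
    show "f s \<ge> 0" using s s2 by (simp add: f_def)
    \<comment> \<open>The special defining function as a function of the radius; it turns the density in \<open>s\<close> into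
      the derivative of \<open>sinh_primitive\<close>.\<close>
    define t where "t = (1 - s) / (1 + s)"
    have t: "t > 0" using s by (simp add: t_def)
    have "1 / t - t = 4 * s / (1 - s\<^sup>2)"
      using s s2 by (simp add: t_def divide_simps) (simp add: power2_eq_square algebra_simps)
    then have "?A / 2 ^ n * ((1 / t - t) ^ n / t) * (2 / (1 + s)\<^sup>2) = ?A / 2 ^ n * ((4 * s / (1 - s\<^sup>2)) ^ n) * (2 / (t * (1 + s)\<^sup>2))"
      by simp
    also have "t * (1 + s)\<^sup>2 = 1 - s\<^sup>2"
      using s by (simp add: t_def power2_eq_square field_simps)
    also have "?A / 2 ^ n * ((4 * s / (1 - s\<^sup>2)) ^ n) * (2 / (1 - s\<^sup>2)) = f s"
    proof -
      have "4 * s / (1 - s\<^sup>2) = 2 * (s * (2 / (1 - s\<^sup>2)))" by simp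
      then show ?thesis by (simp only: f_def power_mult_distrib) simp
    qed
    finally have eq: "?A / 2 ^ n * ((1 / t - t) ^ n / t) * (2 / (1 + s)\<^sup>2) = f s" .
    have "((\<lambda>s. (1 - s) / (1 + s)) has_real_derivative - (2 / (1 + s)\<^sup>2)) (at s)"
      using s by (auto intro!: derivative_eq_intros simp: power2_eq_square divide_simps)
    from DERIV_cmult[OF DERIV_chain2[OF sinh_primitive_deriv[OF n(1) t, unfolded t_def] this], of "- (?A / 2 ^ n)"]
    show "(F has_real_derivative f s) (at s)"
      unfolding F_def eq[symmetric] t_def
      by (rule DERIV_cong) (simp only: mult_minus_right mult_minus_left minus_minus mult.assoc)
  qed (use R in \<open>auto simp: f_def\<close>)
  also have "F R - F 0 = ?A / 2 ^ n * (sinh_primitive n 1 - sinh_primitive n ((1 - R) / (1 + R)))"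
    by (simp add: F_def right_diff_distrib diff_divide_distrib del: of_nat_add of_nat_Suc)
  finally show ?thesis .
qed

section \<open>The constant term\<close>

text \<open>For \<open>x > 0\<close> this is the integral of \<open>s powr (x - 1) * (1 - s) ^ n\<close> over the unit interval, expanded
  binomially. At negative \<open>x\<close>, where the integral diverges, only the recursion
  \<open>Beta (x + 1) y + Beta x (y + 1) = Beta x y\<close>, which mirrors Pascal's rule, is left as an argument.\<close>

lemma alternating_binomial_sum_eq_Beta:
  fixes x :: real
  assumes "x \<notin> \<int>\<^sub>\<le>\<^sub>0"
  shows "(\<Sum>k\<le>n. (-1) ^ k * real (n choose k) / (x + real k)) = Beta x (real n + 1)"
  using assms
proof (induction n arbitrary: x)
  case 0
  then have "x \<noteq> 0" by auto
  then show ?case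
    using 0 Gamma_eq_zero_iff[of x] by (simp add: Beta_def Gamma_plus1)
next
  case (Suc n)
  define g where "g k = (-1) ^ k / (x + real k)" for k
  have x1: "x + 1 \<notin> \<int>\<^sub>\<le>\<^sub>0"
    using Suc.prems plus_one_in_nonpos_Ints_imp by blast
  have "(\<Sum>k\<le>Suc n. real (Suc n choose k) * g k)
      = g 0 + (\<Sum>k\<le>n. real (n choose Suc k) * g (Suc k)) + (\<Sum>k\<le>n. real (n choose k) * g (Suc k))"
    by (simp add: sum.atMost_Suc_shift sum.distrib algebra_simps del: sum.atMost_Suc)
  also have "g 0 + (\<Sum>k\<le>n. real (n choose Suc k) * g (Suc k)) = (\<Sum>k\<le>Suc n. real (n choose k) * g k)"
    by (simp add: sum.atMost_Suc_shift del: sum.atMost_Suc)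
  also have "\<dots> = (\<Sum>k\<le>n. real (n choose k) * g k)" by simp
  also have "\<dots> = Beta x (real n + 1)"
    using Suc.IH[OF Suc.prems] by (simp add: g_def mult.commute)
  also have "(\<Sum>k\<le>n. real (n choose k) * g (Suc k)) = - Beta (x + 1) (real n + 1)"
    unfolding Suc.IH[OF x1, symmetric] sum_negf[symmetric]
    by (intro sum.cong) (auto simp: g_def algebra_simps)
  also have "Beta x (real n + 1) + - Beta (x + 1) (real n + 1) = Beta x (real (Suc n) + 1)"
    using Beta_plus1_plus1[OF Suc.prems, of "real n + 1"]
    by (simp add: add_ac nonpos_Ints_def)
  finally show ?case by (simp add: g_def mult.commute)
qed

lemma Gamma_duplication_nat:
  "Gamma ((real n + 1) / 2) * Gamma (real n / 2 + 1) = sqrt pi * Gamma (real n + 1) / 2 ^ n"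
proof -
  define z :: real where "z = (real n + 1) / 2"
  have z: "z > 0" by (simp add: z_def)
  have nz: "complex_of_real y \<notin> \<int>\<^sub>\<le>\<^sub>0" if "y > 0" for y
    using that by (auto elim!: nonpos_Ints_cases simp: complex_eq_iff)
  have "complex_of_real (Gamma z * Gamma (z + 1/2))
      = Gamma (complex_of_real z) * Gamma (complex_of_real z + 1/2)"
    by (simp flip: Gamma_complex_of_real)
  also have "\<dots> = exp ((1 - 2 * complex_of_real z) * of_real (ln 2)) * of_real (sqrt pi) * Gamma (2 * complex_of_real z)"
    using nz[OF z] nz[of "z + 1/2"] z by (intro Gamma_legendre_duplication) auto
  also have "\<dots> = complex_of_real (exp ((1 - 2 * z) * ln 2) * sqrt pi * Gamma (2 * z))"
    by (simp flip: Gamma_complex_of_real exp_of_real)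
  finally have "Gamma z * Gamma (z + 1/2) = exp ((1 - 2 * z) * ln 2) * sqrt pi * Gamma (2 * z)"
    using of_real_eq_iff by blast
  moreover have "exp ((1 - 2 * z) * ln 2) = 1 / 2 ^ n"
  proof -
    have "(1 - 2 * z) * ln 2 = - (real n * ln 2)" by (simp add: z_def add_divide_distrib)
    moreover have "exp (real n * ln 2) = (2 :: real) ^ n" by (subst exp_of_nat_mult) simp
    ultimately show ?thesis by (simp only: exp_minus divide_inverse)
  qed
  moreover have "2 * z = real n + 1" "z + 1/2 = real n / 2 + 1"
    by (auto simp: z_def field_simps)
  ultimately have "Gamma z * Gamma (real n / 2 + 1) = 1 / 2 ^ n * sqrt pi * Gamma (real n + 1)"
    by (simp only:)
  then show ?thesis by (simp add: z_def)
qed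

text \<open>Euler's reflection formula at \<open>- n / 2\<close>, where the sine takes the values \<open>\<plusminus>1\<close>. This is the source
  of the sign of the renormalized volume.\<close>

lemma Gamma_reflection_odd:
  assumes "odd n"
  shows "Gamma (- (real n / 2)) * Gamma (real n / 2 + 1) = pi * (-1) ^ ((n + 1) div 2)"
proof -
  obtain m where m: "n = 2 * m + 1" using assms by (elim oddE)
  define z :: real where "z = - (real n / 2)"
  have "complex_of_real (Gamma z * Gamma (1 - z)) = Gamma (complex_of_real z) * Gamma (1 - complex_of_real z)"
    by (simp flip: Gamma_complex_of_real)
  also have "\<dots> = complex_of_real (pi / sin (pi * z))"
    by (simp add: Gamma_reflection_complex flip: sin_of_real)
  finally have "Gamma z * Gamma (1 - z) = pi / sin (pi * z)"
    using of_real_eq_iff by blast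
  moreover have "sin (pi * z) = (-1) ^ Suc m"
  proof -
    have "pi * z = - (real m * pi + pi / 2)" by (simp add: z_def m field_simps)
    then show ?thesis by (simp only: sin_minus sin_add) simp
  qed
  ultimately show ?thesis by (cases "even m") (simp_all add: z_def m add.commute)
qed

text \<open>At \<open>t = 1\<close> the primitive is half a Beta value at the pole-free point \<open>- n / 2\<close>. The duplication formula
  cancels the area of the sphere against the factorials and leaves \<open>pi powr (n / 2) * Gamma (- n / 2)\<close>;
  reflection moves the argument of Gamma to \<open>n / 2 + 1\<close>.\<close>

lemma sinh_primitive_1:
  assumes "odd n"
  shows "real (n + 1) * unit_ball_vol (real (n + 1)) / 2 ^ n * sinh_primitive n 1
    = (-1) ^ ((n + 1) div 2) * pi powr ((real n + 2) / 2) / Gamma ((real n + 2) / 2)"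
proof -
  have x: "- (real n / 2) \<notin> \<int>\<^sub>\<le>\<^sub>0"
  proof
    assume "- (real n / 2) \<in> \<int>\<^sub>\<le>\<^sub>0"
    then obtain i where "- (real n / 2) = of_int i" by (auto elim: nonpos_Ints_cases)
    then have "real_of_int (int n) = real_of_int (- 2 * i)" by simp
    then have "int n = - 2 * i" by linarith
    then show False using assms by presburger
  qed
  have "sinh_primitive n 1 = (\<Sum>k\<le>n. (-1) ^ k * real (n choose k) / (- (real n / 2) + real k)) / 2"
    unfolding sinh_primitive_def sum_divide_distrib
    by (intro sum.cong) (auto simp: divide_simps)
  also have "\<dots> = Gamma (- (real n / 2)) * Gamma (real n + 1) / Gamma (real n / 2 + 1) / 2"
    using alternating_binomial_sum_eq_Beta[OF x, of n] by (simp add: Beta_def)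
  finally have s: "sinh_primitive n 1 = \<dots>" .
  have nz: "Gamma (real n / 2 + 1) \<noteq> 0" "Gamma ((real n + 1) / 2) \<noteq> 0"
    by (intro less_imp_neq[symmetric] Gamma_real_pos; simp)+
  have "real (n + 1) * unit_ball_vol (real (n + 1)) = 2 * pi powr ((real n + 1) / 2) / Gamma ((real n + 1) / 2)"
  proof -
    have "(real n + 1) / 2 \<notin> \<int>\<^sub>\<le>\<^sub>0"
      using nz(2) Gamma_eq_zero_iff[of "(real n + 1) / 2"] by force
    then have eq: "Gamma (real (n + 1) / 2 + 1) = (real n + 1) / 2 * Gamma ((real n + 1) / 2)"
      using Gamma_plus1[of "(real n + 1) / 2"] by (simp add: add_ac)
    have "unit_ball_vol (real (n + 1)) =
        pi powr ((real n + 1) / 2) / ((real n + 1) / 2 * Gamma ((real n + 1) / 2))"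
      unfolding unit_ball_vol_def eq by (simp add: add.commute)
    then show ?thesis by (simp only: of_nat_add of_nat_1) simp
  qed
  then have "real (n + 1) * unit_ball_vol (real (n + 1)) / 2 ^ n * sinh_primitive n 1
     = pi powr ((real n + 1) / 2) * Gamma (- (real n / 2)) * (Gamma (real n + 1) / 2 ^ n)
       / (Gamma ((real n + 1) / 2) * Gamma (real n / 2 + 1))"
    unfolding s by (simp add: mult_ac)
  also have "Gamma (real n + 1) / 2 ^ n = Gamma ((real n + 1) / 2) * Gamma (real n / 2 + 1) / sqrt pi"
    unfolding Gamma_duplication_nat by simp
  also have "pi powr ((real n + 1) / 2) * Gamma (- (real n / 2)) * \<dots> / (Gamma ((real n + 1) / 2) * Gamma (real n / 2 + 1))
     = pi powr ((real n + 1) / 2) / sqrt pi * Gamma (- (real n / 2))"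
    using nz by simp
  also have "pi powr ((real n + 1) / 2) / sqrt pi = pi powr (real n / 2)"
    by (simp only: add_divide_distrib powr_add powr_half_sqrt pi_ge_zero) simp
  also have "Gamma (- (real n / 2)) = pi * (-1) ^ ((n + 1) div 2) / Gamma (real n / 2 + 1)"
    using Gamma_reflection_odd[OF assms] nz(1) by (metis nonzero_eq_divide_eq)
  also have "pi powr (real n / 2) * \<dots> = (-1) ^ ((n + 1) div 2) * pi powr ((real n + 2) / 2) / Gamma ((real n + 2) / 2)"
  proof -
    have "(real n + 2) / 2 = real n / 2 + 1" by simp
    then show ?thesis by (simp only: powr_add) simp
  qed
  finally show ?thesis .
qed

section \<open>The renormalized volume\<close>

text \<open>The volume is exactly \<open>A * (sinh_primitive n 1 - sinh_primitive n \<epsilon>)\<close>. In the second term the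
  powers with negative exponent are those of the expansion, and the remaining ones tend to 0, as none
  has exponent 0. Hence the constant term is \<open>A * sinh_primitive n 1\<close>.\<close>

lemma volume_expansion_hyperbolic:
  fixes r :: "real ^ 'd::finite \<Rightarrow> real"
  assumes n: "odd n" "CARD('d) = n + 1"
    and r: "\<And>x. r x = (1 - norm x) / (1 + norm x)"
  defines "A \<equiv> real (n + 1) * unit_ball_vol (real (n + 1)) / 2 ^ n"
  shows "volume_expansion n (hyperbolic_metric :: 'd metric) (- {0}) r
    (\<lambda>m. - A * (-1) ^ (m div 2) * real (n choose (m div 2)) / (real m - real n))
    (A * sinh_primitive n 1)"
proof -
  let ?\<mu> = "riemannian_measure (hyperbolic_metric :: 'd metric)"
  define T where "T k \<epsilon> = (-1) ^ k * real (n choose k) * \<epsilon> powi (2 * int k - int n) / (2 * real k - real n)" for k and \<epsilon> :: real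
  have superlevel: "superlevel (- {0}) r \<epsilon> = ball 0 ((1 - \<epsilon>) / (1 + \<epsilon>))" if "0 < \<epsilon>" "\<epsilon> < 1" for \<epsilon>
  proof -
    have "0 < r x \<and> r x \<le> \<epsilon> \<longleftrightarrow> (1 - \<epsilon>) / (1 + \<epsilon>) \<le> norm x" if "norm x < 1" for x
    proof -
      have "r x \<le> \<epsilon> \<longleftrightarrow> 1 - norm x \<le> \<epsilon> * (1 + norm x)"
        by (simp add: r pos_divide_le_eq add_pos_nonneg)
      also have "\<dots> \<longleftrightarrow> 1 - \<epsilon> \<le> norm x * (1 + \<epsilon>)"
        by (simp add: algebra_simps)
      also have "\<dots> \<longleftrightarrow> (1 - \<epsilon>) / (1 + \<epsilon>) \<le> norm x"
        using \<open>0 < \<epsilon>\<close> by (simp add: pos_divide_le_eq)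
      finally show ?thesis
        using that by (simp add: r add_pos_nonneg)
    qed
    moreover have "0 < (1 - \<epsilon>) / (1 + \<epsilon>)" "(1 - \<epsilon>) / (1 + \<epsilon>) < 1" using that by auto
    ultimately show ?thesis
      unfolding superlevel_def
      by (intro set_eqI iffI) (force simp: not_le)+
  qed
  have vol: "emeasure ?\<mu> (superlevel (- {0}) r \<epsilon>) = ennreal (A * (sinh_primitive n 1 - sinh_primitive n \<epsilon>))"
    if "0 < \<epsilon>" "\<epsilon> < 1" for \<epsilon>
  proof -
    define R where "R = (1 - \<epsilon>) / (1 + \<epsilon>)"
    have "0 \<le> R" "R < 1" "(1 - R) / (1 + R) = \<epsilon>"
      using that by (auto simp: R_def field_simps)
    then show ?thesis
      using emeasure_hyperbolic_ball[OF n, of R] superlevel[OF that] by (simp add: A_def R_def)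
  qed
  have mono: "sinh_primitive n \<epsilon> \<le> sinh_primitive n 1" if "0 < \<epsilon>" "\<epsilon> < 1" for \<epsilon>
  proof (rule DERIV_nonneg_imp_nondecreasing[where f = "sinh_primitive n"])
    fix t assume t: "\<epsilon> \<le> t" "t \<le> 1"
    then have "1 / t - t \<ge> 0"
      using that by (simp add: field_simps mult_le_one)
    then show "\<exists>y. (sinh_primitive n has_real_derivative y) (at t) \<and> 0 \<le> y"
      using sinh_primitive_deriv[OF n(1), of t] t that by (intro exI conjI) auto
  qed (use that in auto)
  have A: "A \<ge> 0" by (simp add: A_def)
  have meas: "measure ?\<mu> (superlevel (- {0}) r \<epsilon>) = A * (sinh_primitive n 1 - sinh_primitive n \<epsilon>)"
    if "0 < \<epsilon>" "\<epsilon> < 1" for \<epsilon>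
    using vol[OF that] mono[OF that] A by (simp add: measure_def)
  have small: "\<forall>\<^sub>F \<epsilon> in at_right 0. \<epsilon> \<in> {0<..<1::real}"
    by (rule eventually_at_right_real) simp
  have split: "{..n} = {..(n - 1) div 2} \<union> {(n - 1) div 2<..n}" "{..(n - 1) div 2} \<inter> {(n - 1) div 2<..n} = {}"
    using n(1) by (auto elim!: oddE)
  have "((\<lambda>\<epsilon>. A * sinh_primitive n 1 - A * (\<Sum>k\<in>{(n - 1) div 2<..n}. T k \<epsilon>)) \<longlongrightarrow>
      A * sinh_primitive n 1 - A * (\<Sum>k\<in>{(n - 1) div 2<..n}. 0)) (at_right 0)"
  proof (intro tendsto_intros)
    fix k assume "k \<in> {(n - 1) div 2<..n}"
    then have k: "2 * int k - int n = int (2 * k - n)" "2 * k - n > 0"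
      using n(1) by (auto elim!: oddE)
    have "((\<lambda>\<epsilon>. (-1) ^ k * real (n choose k) * \<epsilon> ^ (2 * k - n) / (2 * real k - real n)) \<longlongrightarrow>
        (-1) ^ k * real (n choose k) * 0 ^ (2 * k - n) / (2 * real k - real n)) (at_right 0)"
      using k by (intro tendsto_intros) linarith
    then show "(T k \<longlongrightarrow> 0) (at_right 0)"
      unfolding T_def k(1) power_int_of_nat using k(2) by (simp add: power_0_left)
  qed
  moreover have "\<forall>\<^sub>F \<epsilon> in at_right 0. A * sinh_primitive n 1 - A * (\<Sum>k\<in>{(n - 1) div 2<..n}. T k \<epsilon>)
     = measure ?\<mu> (superlevel (- {0}) r \<epsilon>)
       - (\<Sum>j\<le>(n - 1) div 2. - A * (-1) ^ (2 * j div 2) * real (n choose (2 * j div 2)) / (real (2 * j) - real n) * \<epsilon> powi (2 * int j - int n))"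
    using small
  proof eventually_elim
    case (elim \<epsilon>)
    have "sinh_primitive n \<epsilon> = (\<Sum>k\<le>(n - 1) div 2. T k \<epsilon>) + (\<Sum>k\<in>{(n - 1) div 2<..n}. T k \<epsilon>)"
      unfolding sinh_primitive_def T_def[symmetric] by (subst split(1), rule sum.union_disjoint) (use split(2) in auto)
    moreover have "(\<Sum>j\<le>(n - 1) div 2. - A * (-1) ^ (2 * j div 2) * real (n choose (2 * j div 2)) / (real (2 * j) - real n) * \<epsilon> powi (2 * int j - int n))
       = - A * (\<Sum>k\<le>(n - 1) div 2. T k \<epsilon>)"
      unfolding sum_distrib_left by (intro sum.cong) (auto simp: T_def)
    ultimately show ?case
      using elim by (simp add: meas algebra_simps)
  qed
  ultimately have "((\<lambda>\<epsilon>. measure ?\<mu> (superlevel (- {0}) r \<epsilon>)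
       - (\<Sum>j\<le>(n - 1) div 2. - A * (-1) ^ (2 * j div 2) * real (n choose (2 * j div 2)) / (real (2 * j) - real n) * \<epsilon> powi (2 * int j - int n)))
      \<longlongrightarrow> A * sinh_primitive n 1) (at_right 0)"
    by (simp add: tendsto_cong[THEN iffD1])
  moreover have "\<forall>\<^sub>F \<epsilon> in at_right 0. emeasure ?\<mu> (superlevel (- {0}) r \<epsilon>) < \<infinity>"
    using small by eventually_elim (simp add: vol)
  ultimately show ?thesis
    unfolding volume_expansion_def by blast
qed

theorem mainTheorem3:
  fixes n :: nat
  assumes "n \<ge> 1" and "odd n" and "CARD('d::finite) = n + 1"
  shows "is_renormalized_volume (hyperbolic_metric :: 'd metric)
           ((- 1) ^ ((n + 1) div 2) * pi powr ((real n + 2) / 2) / Gamma ((real n + 2) / 2))"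
proof -
  let ?g = "hyperbolic_metric :: 'd metric"
  let ?r = "\<lambda>x :: real ^ 'd. (1 - norm x) / (1 + norm x)"
  let ?V = "(- 1) ^ ((n + 1) div 2) * pi powr ((real n + 2) / 2) / Gamma ((real n + 2) / 2)"
  have "conformally_compact ?g"
    unfolding conformally_compact_def
    using riemannian_metric_hyperbolic compactified_metric_hyperbolic by blast
  moreover have "in_conformal_infinity ?g (\<lambda>p u v. (u \<bullet> v) / 4)"
    unfolding in_conformal_infinity_def
    by (rule exI, rule exI, rule exI, rule exI[of _ "\<lambda>_. 1"], rule conjI[OF compactified_metric_hyperbolic])
       (auto simp: smooth_on_def Ck_on_const mat_mult_vec)
  moreover have "\<exists>c. volume_expansion (CARD('d) - 1) ?g (- {0}) ?r c ?V"
  proof -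
    have card: "CARD('d) - 1 = n" using assms(3) by simp
    show ?thesis
      unfolding card sinh_primitive_1[OF assms(2), symmetric]
      by (rule exI, rule volume_expansion_hyperbolic[OF assms(2,3) refl])
  qed
  ultimately show ?thesis
    unfolding is_renormalized_volume_def
    using special_defining_function_hyperbolic by blast
qed

end
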